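(* The infinitesimal generator of the Markov process $\Xi(t)=(X(t),\xi(t))$ on $\mathbb{R}\times\{0,1\}$ is $\Lambda+\mathcal{L}$, where $$\mathcal{L}=\mathcal{L}^x=\begin{pmatrix} L_0^x & 0\\ 0 & L_1^x\end{pmatrix},\qquad L_i^x=(c_i-U'(x))\frac{\partial}{\partial x},\ i\in\{0,1\},\qquad \Lambda=\begin{pmatrix}-\lambda_0&\lambda_0\\ \lambda_1&-\lambda_1\end{pmatrix}.$$ That is, on test functions $\boldsymbol f=(f_0,f_1)$ the generator acts by $(\Lambda\boldsymbol f+\mathcal{L}\boldsymbol f)_i(x)=(c_i-U'(x))f_i'(x)-\lambda_i f_i(x)+\lambda_i f_{1-i}(x)$, $i\in\{0,1\}$.
   Context: Let $U\in C^2(-\infty,\infty)$ be a double-well potential: it has a local maximum at $x_0$ and two local minima at $x_-,x_+$ with $x_-<x_0<x_+$, and $U''(x)\neq0$ for $x\in\{x_-,x_0,x_+\}$. Let $c_0>c_1$ be real, and let $\xi=\xi(t)\in\{0,1\}$ be a two-state Markov process which switches from state $0$ to $1$ with intensity $\lambda_0>0$ and from $1$ to $0$ with intensity $\lambda_1>0$. The telegraph process is $\mathbb{T}(t)=\int_0^t c_{\xi(s)}\,ds$, and $X=X^x(t)$ is the solution of $dX(t)=-U'(X(t))\,dt+d\mathbb{T}(t)$, $t>0$, $X(0)=x$. Thus $X$ is continuous and, while $\xi=i$, it follows the flow $\gamma_i(t,x)$ given by $\partial_t\gamma_i(t,x)=c_i-U'(\gamma_i(t,x))$, $\gamma_i(0,x)=x$.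 Set $U_i(x)=U(x)-c_ix$; it is assumed that the integral $\int\frac{dy}{U_i'(y)}$ diverges at every critical point of $U_i$ (no blow-up). The Markov semigroup of $\Xi$ is $(P_t\boldsymbol f)_i(x)=\mathbb{E}[f_{\xi(t)}(X(t))\mid X(0)=x,\xi(0)=i]$, and the infinitesimal generator is its derivative at $t=0$. *)

theory Defs
  imports "HOL-Probability.Probability"
begin

text \<open>The state space \<open>{0, 1}\<close> is the two-element type \<open>2\<close> of integers modulo two, so that
  \<open>1 - i\<close> is the other state and pairs of functions \<open>(f\<^sub>0, f\<^sub>1)\<close> are functions into \<open>real^2\<close>.
  Beware that \<open>(2::2) = 0\<close>: the components of a vector are \<open>v $ 0\<close> and \<open>v $ 1\<close>.
  Processes are indexed by \<open>real\<close>, and only their values at times \<open>t \<ge> 0\<close> matter.\<close>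

definition double_well ::
  "(real \<Rightarrow> real) \<Rightarrow> (real \<Rightarrow> real) \<Rightarrow> (real \<Rightarrow> real) \<Rightarrow> real \<Rightarrow> real \<Rightarrow> real \<Rightarrow> bool" where
  "double_well U U' U'' xm x0 xp \<longleftrightarrow>
     (\<forall>x. (U has_real_derivative U' x) (at x)) \<and>
     (\<forall>x. (U' has_real_derivative U'' x) (at x)) \<and>
     continuous_on UNIV U'' \<and>
     xm < x0 \<and> x0 < xp \<and>
     (\<forall>\<^sub>F y in at x0. U y \<le> U x0) \<and>
     (\<forall>\<^sub>F y in at xm. U xm \<le> U y) \<and>
     (\<forall>\<^sub>F y in at xp. U xp \<le> U y) \<and>
     U'' xm \<noteq> 0 \<and> U'' x0 \<noteq> 0 \<and> U'' xp \<noteq> 0"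

text \<open>Divergence of \<open>\<integral> dy / U\<^sub>i'(y)\<close>, where \<open>U\<^sub>i'(y) = U'(y) - c\<^sub>i\<close>, at every critical point of
  \<open>U\<^sub>i\<close>, on either side of it. In \<open>ennreal\<close> the inverse of \<open>0\<close> is \<open>\<infinity>\<close>, so further zeros
  of \<open>U\<^sub>i'\<close> near the critical point cause no artefact.\<close>

definition divergent_at_critical_points :: "(real \<Rightarrow> real) \<Rightarrow> (2 \<Rightarrow> real) \<Rightarrow> bool" where
  "divergent_at_critical_points U' c \<longleftrightarrow>
     (\<forall>i z. U' z - c i = 0 \<longrightarrow> (\<forall>\<epsilon>>0.
        (\<integral>\<^sup>+ y \<in> {z<..<z + \<epsilon>}. inverse (ennreal \<bar>U' y - c i\<bar>) \<partial>lborel) = \<infinity> \<and>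
        (\<integral>\<^sup>+ y \<in> {z - \<epsilon><..<z}. inverse (ennreal \<bar>U' y - c i\<bar>) \<partial>lborel) = \<infinity>))"

text \<open>A two-state time-homogeneous Markov process with switching intensities \<open>lam i\<close> (from \<open>i\<close> to
  \<open>1 - i\<close>): random variables whose paths are almost surely right-continuous with left limits for
  the discrete topology on the states, and which satisfy the Markov property with transition
  probabilities \<open>p h i j\<close> such that \<open>p h i (1 - i) = lam i * h + o(h)\<close> as \<open>h \<rightarrow> 0+\<close>.
  The finite set \<open>T\<close> and the map \<open>e\<close> range over all finite-dimensional events of the past.\<close>

definition two_state_markov_process ::
  "'a measure \<Rightarrow> (real \<Rightarrow> 'a \<Rightarrow> 2) \<Rightarrow> (2 \<Rightarrow> real) \<Rightarrow> bool" where
  "two_state_markov_process M \<xi> lam \<longleftrightarrow>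
     (\<forall>t\<ge>0. \<xi> t \<in> measurable M (count_space UNIV)) \<and>
     (AE \<omega> in M.
        (\<forall>t\<ge>0. \<forall>\<^sub>F s in at_right t. \<xi> s \<omega> = \<xi> t \<omega>) \<and>
        (\<forall>t>0. \<exists>j. \<forall>\<^sub>F s in at_left t. \<xi> s \<omega> = j)) \<and>
     (\<exists>p :: real \<Rightarrow> 2 \<Rightarrow> 2 \<Rightarrow> real.
        (\<forall>s\<ge>0. \<forall>h\<ge>0. \<forall>i j. \<forall>T e. finite T \<longrightarrow> T \<subseteq> {0..s} \<longrightarrow>
           measure M {\<omega> \<in> space M. (\<forall>r\<in>T. \<xi> r \<omega> = e r) \<and> \<xi> s \<omega> = i \<and> \<xi> (s + h) \<omega> = j} =
           measure M {\<omega> \<in> space M. (\<forall>r\<in>T. \<xi> r \<omega> = e r) \<and> \<xi> s \<omega> = i} * p h i j) \<and>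
        (\<forall>i. ((\<lambda>h. p h i (1 - i) / h) \<longlongrightarrow> lam i) (at_right 0)))"

definition telegraph :: "(2 \<Rightarrow> real) \<Rightarrow> (real \<Rightarrow> 'a \<Rightarrow> 2) \<Rightarrow> real \<Rightarrow> 'a \<Rightarrow> real" where
  "telegraph c \<xi> t \<omega> = integral {0..t} (\<lambda>s. c (\<xi> s \<omega>))"

text \<open>\<open>Y\<close> solves \<open>dY(t) = - U'(Y(t)) dt + dT(t)\<close>, \<open>Y(0) = x\<close>, in integrated form, where \<open>T\<close> is the
  telegraph process.\<close>

definition is_solution ::
  "'a measure \<Rightarrow> (2 \<Rightarrow> real) \<Rightarrow> (real \<Rightarrow> real) \<Rightarrow> (real \<Rightarrow> 'a \<Rightarrow> 2) \<Rightarrow> real \<Rightarrow> (real \<Rightarrow> 'a \<Rightarrow> real) \<Rightarrow> bool"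
  where
  "is_solution M c U' \<xi> x Y \<longleftrightarrow>
     (\<forall>t\<ge>0. Y t \<in> borel_measurable M) \<and>
     (AE \<omega> in M. continuous_on {0..} (\<lambda>t. Y t \<omega>) \<and>
        (\<forall>t\<ge>0. Y t \<omega> = x - integral {0..t} (\<lambda>s. U' (Y s \<omega>)) + telegraph c \<xi> t \<omega>))"

text \<open>\<open>(P\<^sub>t f)\<^sub>i(x)\<close> is the expectation of \<open>f\<^sub>j(X\<^sup>x(t))\<close>, \<open>j = \<xi>(t)\<close>, conditional on the event
  \<open>\<xi>(0) = i\<close>.\<close>

definition markov_semigroup ::
  "'a measure \<Rightarrow> (real \<Rightarrow> 'a \<Rightarrow> 2) \<Rightarrow> (real \<Rightarrow> real \<Rightarrow> 'a \<Rightarrow> real) \<Rightarrow>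
     real \<Rightarrow> (real \<Rightarrow> real^2) \<Rightarrow> real \<Rightarrow> real^2" where
  "markov_semigroup M \<xi> X t f x =
     (\<chi> i. LINT \<omega> | uniform_measure M {\<omega> \<in> space M. \<xi> 0 \<omega> = i}. f (X x t \<omega>) $ \<xi> t \<omega>)"

text \<open>The generator is the derivative at \<open>t = 0\<close> (from the right) of the semigroup: pointwise in
  \<open>x\<close>, respectively in the supremum norm.\<close>

definition pointwise_generator ::
  "(real \<Rightarrow> (real \<Rightarrow> real^2) \<Rightarrow> real \<Rightarrow> real^2) \<Rightarrow> (real \<Rightarrow> real^2) \<Rightarrow> (real \<Rightarrow> real^2) \<Rightarrow> bool" where
  "pointwise_generator P f g \<longleftrightarrow>
     (\<forall>x. ((\<lambda>t. P t f x) has_vector_derivative g x) (at 0 within {0..}))"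

definition uniform_generator ::
  "(real \<Rightarrow> (real \<Rightarrow> real^2) \<Rightarrow> real \<Rightarrow> real^2) \<Rightarrow> (real \<Rightarrow> real^2) \<Rightarrow> (real \<Rightarrow> real^2) \<Rightarrow> bool" where
  "uniform_generator P f g \<longleftrightarrow>
     uniform_limit UNIV (\<lambda>t x. (P t f x - f x) /\<^sub>R t) g (at_right 0)"

definition Lambda :: "(2 \<Rightarrow> real) \<Rightarrow> real^2^2" where
  "Lambda lam = (\<chi> i j. if j = i then - lam i else lam i)"

definition L_op :: "(2 \<Rightarrow> real) \<Rightarrow> (real \<Rightarrow> real) \<Rightarrow> 2 \<Rightarrow> (real \<Rightarrow> real) \<Rightarrow> real \<Rightarrow> real" where
  "L_op c U' i g x = (c i - U' x) * deriv g x"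

definition L_diag :: "(2 \<Rightarrow> real) \<Rightarrow> (real \<Rightarrow> real) \<Rightarrow> (real \<Rightarrow> real^2) \<Rightarrow> real \<Rightarrow> real^2" where
  "L_diag c U' f x = (\<chi> i. L_op c U' i (\<lambda>y. f y $ i) x)"

end

theory Submission
  imports Defs
begin

text \<open>The proof compares \<open>f(X(t))\<close>, taken in the component \<open>\<xi>(t)\<close>, path by path with the first-order prediction
  \<open>f\<^sub>i(x) + t g\<^sub>i(x) + 1{\<xi>(t) \<noteq> i} (f\<^sub>1\<^sub>-\<^sub>i(x) - f\<^sub>i(x))\<close>, where \<open>\<xi>(0) = i\<close> and
  \<open>g\<^sub>i = (c\<^sub>i - V) f\<^sub>i'\<close> with the drift \<open>V = U'\<close>. In expectation the indicator becomes
  \<open>P(\<xi>(t) = 1 - i | \<xi>(0) = i)\<close>, which by the Markov property is \<open>\<lambda>\<^sub>i t + o(t)\<close>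
  (\<open>transition_rate\<close>); so the derivative of the expected prediction is the claimed generator.

  The error of the prediction is controlled in two ways. On a path without a switch up to time \<open>t\<close>
  the position follows the smooth flow of state \<open>i\<close>, and by the mean value theorem the error is at
  most \<open>t\<close> times the oscillation of \<open>g\<^sub>i\<close> near \<open>x\<close> (\<open>expansion_before_jump\<close>). On every other path
  the error is still at most a constant times \<open>t\<close> (\<open>expansion_bound\<close>), and the probability of such
  paths tends to \<open>0\<close> because almost every path of \<open>\<xi>\<close> is right-continuous at \<open>0\<close>
  (\<open>leaves_before_tendsto_0\<close>). Hence the expected error is \<open>o(t)\<close>.

  All constants depend on \<open>x\<close> only through a bound for \<open>\<bar>x\<bar>\<close>: the velocity is at most some \<open>B\<close> on a
  bounded set, and in a short time the position moves by at most \<open>B t\<close> (\<open>short_displacement\<close>). So the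
  difference quotients converge uniformly on bounded sets (\<open>locally_uniform_derivative\<close>), which
  contains the pointwise statement. If the test function has compact support, then a path that starts
  far enough from the support does not reach it in a short time, and the semigroup and the claimed
  generator both vanish there (\<open>semigroup_vanishes_far_away\<close>); the convergence is then uniform on
  the whole line.\<close>

section \<open>Deterministic paths driven by a switching state\<close>

text \<open>A slow path needs time to get away from its start: at the first time at distance exactly \<open>1\<close> the
  speed bound would still be in force and give a distance of at most \<open>B * t < 1\<close>. The bound is
  assumed only while the path is confined, because a drift is bounded only on bounded sets.\<close>

lemma confinement:
  fixes w :: "real \<Rightarrow> real"
  assumes cont: "continuous_on {0..t} w" and t: "0 \<le> t" "B * t < 1" "0 \<le> B"
    and slow: "\<And>s. 0 \<le> s \<Longrightarrow> s \<le> t \<Longrightarrow> (\<And>r. 0 \<le> r \<Longrightarrow> r \<le> s \<Longrightarrow> \<bar>w r - w 0\<bar> \<le> 1) \<Longrightarrow> \<bar>w s - w 0\<bar> \<le> B * s"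
  shows "\<bar>w t - w 0\<bar> \<le> B * t"
proof -
  define h where "h r = \<bar>w r - w 0\<bar>" for r
  have h: "continuous_on {0..t} h" unfolding h_def by (intro continuous_intros cont)
  have crossing: "\<exists>q\<in>{0..r}. h q = 1" if "0 \<le> r" "r \<le> t" "h r > 1" for r
    using IVT'[of h 0 1 r] that continuous_on_subset[OF h] by (auto simp: h_def)
  define S where "S = {0..t} \<inter> h -` {1}"
  have "S = {}"
  proof (rule ccontr)
    assume "S \<noteq> {}"
    have "closed S" unfolding S_def
      by (rule continuous_closed_preimage[OF h]) auto
    then have "compact S"
      using compact_Int_closed[of "{0..t}" S] by (simp add: S_def Int_absorb1)
    from compact_attains_inf[OF this \<open>S \<noteq> {}\<close>] obtain q where q: "q \<in> S" "\<And>r. r \<in> S \<Longrightarrow> q \<le> r" by blast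
    have "h r \<le> 1" if r: "0 \<le> r" "r \<le> q" for r
    proof (rule ccontr)
      assume "\<not> h r \<le> 1"
      then obtain p where "p \<in> {0..r}" "h p = 1" using crossing[of r] r q(1) by (auto simp: S_def)
      then have "q \<le> p" using q that by (auto simp: S_def)
      with \<open>p \<in> {0..r}\<close> that have "p = r" by auto
      with \<open>h p = 1\<close> \<open>\<not> h r \<le> 1\<close> show False by simp
    qed
    then have "h q \<le> B * q" using slow[of q] q(1) by (auto simp: S_def h_def)
    also have "\<dots> \<le> B * t" using q(1) t by (auto simp: S_def intro: mult_left_mono)
    finally show False using q(1) t by (simp add: S_def)
  qed
  then have "h r \<le> 1" if "0 \<le> r" "r \<le> t" for r
    using crossing[of r] that by (fastforce simp: S_def not_le[symmetric])
  then show ?thesis using slow[of t] t by (auto simp: h_def)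
qed

text \<open>A single realisation: \<open>z\<close> is the trajectory of the state and \<open>y\<close> that of the position.\<close>

locale switching_path =
  fixes c :: "'s \<Rightarrow> real" and V :: "real \<Rightarrow> real" and z :: "real \<Rightarrow> 's" and x :: real and y :: "real \<Rightarrow> real"
  assumes right_continuous: "0 \<le> t \<Longrightarrow> \<forall>\<^sub>F s in at_right t. z s = z t"
    and left_limit: "0 < t \<Longrightarrow> \<exists>j. \<forall>\<^sub>F s in at_left t. z s = j"
    and drift_continuous: "continuous_on UNIV V"
    and path_continuous: "continuous_on {0..} y"
    and path_equation: "0 \<le> t \<Longrightarrow>
      y t = x - integral {0..t} (\<lambda>s. V (y s)) + integral {0..t} (\<lambda>s. c (z s))"
begin

lemma start: "y 0 = x"
  using path_equation[of 0] by simp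

lemma constant_right:
  assumes "0 \<le> t" obtains d where "d > 0" "\<And>s. t \<le> s \<Longrightarrow> s < t + d \<Longrightarrow> z s = z t"
proof -
  obtain b where b: "b > t" "\<And>s. t < s \<Longrightarrow> s < b \<Longrightarrow> z s = z t"
    using right_continuous[OF assms] by (auto simp: eventually_at_right_field)
  show ?thesis
  proof (rule that[of "b - t"])
    show "z s = z t" if "t \<le> s" "s < t + (b - t)" for s
      using b(2)[of s] that by (cases "s = t") auto
  qed (use b in simp)
qed

lemma constant_left:
  assumes "0 < t" obtains j d where "d > 0" "\<And>s. t - d < s \<Longrightarrow> s < t \<Longrightarrow> z s = j"
proof -
  obtain j where "\<forall>\<^sub>F s in at_left t. z s = j" using left_limit[OF assms] by blast
  then obtain b where b: "b < t" "\<And>s. b < s \<Longrightarrow> s < t \<Longrightarrow> z s = j"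
    by (auto simp: eventually_at_left_field)
  show ?thesis using that[of "t - b" j] b by simp
qed

text \<open>Every time has a neighbourhood on either side of which the state is constant. Bolzano's bisection
  principle passes from this local information to bounded intervals without enumerating the jumps.\<close>

lemma velocity_integrable:
  assumes "0 \<le> a" shows "(\<lambda>s. c (z s)) integrable_on {a..b}"
proof (cases "a \<le> b")
  case True
  then have "0 \<le> a \<longrightarrow> (\<lambda>s. c (z s)) integrable_on {a..b}"
  proof (induct rule: Bolzano)
    case (trans a q b)
    then show ?case using Henstock_Kurzweil_Integration.integrable_combine[of a q b "\<lambda>s. c (z s)"] by auto
  next
    case (local t)
    show ?case
    proof (cases "0 \<le> t")
      case True
      obtain d where d: "d > 0" "\<And>s. t \<le> s \<Longrightarrow> s < t + d \<Longrightarrow> z s = z t"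
        using constant_right[OF True] by blast
      have right: "(\<lambda>s. c (z s)) integrable_on {t..b}" if "b < t + d" for b
      proof (rule integrable_eq[of "\<lambda>_. c (z t)"])
        show "c (z t) = c (z s)" if "s \<in> {t..b}" for s
          using d(2)[of s] that \<open>b < t + d\<close> by simp
      qed (rule integrable_const_ivl)
      have "\<exists>j d'. d' > 0 \<and> (\<forall>s. 0 < t \<longrightarrow> t - d' < s \<longrightarrow> s < t \<longrightarrow> z s = j)"
      proof (cases "0 < t")
        case True
        then show ?thesis using constant_left[of t] by metis
      qed (auto intro: exI[of _ 1])
      then obtain j d' where d': "d' > 0" "\<And>s. 0 < t \<Longrightarrow> t - d' < s \<Longrightarrow> s < t \<Longrightarrow> z s = j"
        by blast
      have left: "(\<lambda>s. c (z s)) integrable_on {a..t}" if "t - d' < a" "0 \<le> a" for a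
        by (rule integrable_spike_finite[of "{t}" _ _ "\<lambda>_. c j"]) (use d' that in auto)
      show ?thesis
      proof (intro exI[of _ "min d d'"] conjI allI impI)
        fix a b assume "a \<le> t \<and> t \<le> b \<and> b - a < min d d'" "0 \<le> a"
        then show "(\<lambda>s. c (z s)) integrable_on {a..b}"
          using Henstock_Kurzweil_Integration.integrable_combine[of a t b, OF _ _ left right] by auto
      qed (use d d' in auto)
    qed (auto intro!: exI[of _ 1])
  qed
  with assms show ?thesis by simp
qed auto

lemma drift_integrable:
  assumes "0 \<le> a" shows "(\<lambda>s. V (y s)) integrable_on {a..b}"
  by (intro integrable_continuous_real continuous_on_compose2[OF drift_continuous]
      continuous_on_subset[OF path_continuous]) (use assms in auto)

lemma increment:
  assumes "0 \<le> r" "r \<le> s"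
  shows "((\<lambda>u. c (z u) - V (y u)) has_integral (y s - y r)) {r..s}"
proof -
  have "integral {0..r} (\<lambda>u. c (z u)) + integral {r..s} (\<lambda>u. c (z u)) = integral {0..s} (\<lambda>u. c (z u))"
    "integral {0..r} (\<lambda>u. V (y u)) + integral {r..s} (\<lambda>u. V (y u)) = integral {0..s} (\<lambda>u. V (y u))"
    by (intro Henstock_Kurzweil_Integration.integral_combine velocity_integrable drift_integrable assms; simp)+
  with assms path_equation[of r] path_equation[of s]
  have "y s - y r = integral {r..s} (\<lambda>u. c (z u)) - integral {r..s} (\<lambda>u. V (y u))"
    by simp
  then show ?thesis
    using has_integral_diff[OF integrable_integral[OF velocity_integrable[OF assms(1)]]
       integrable_integral[OF drift_integrable[OF assms(1)]], of s] by simp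
qed

lemma increment_bound:
  assumes "0 \<le> r" "r \<le> s" "0 \<le> B" "\<And>u. r \<le> u \<Longrightarrow> u \<le> s \<Longrightarrow> \<bar>c (z u) - V (y u)\<bar> \<le> B"
  shows "\<bar>y s - y r\<bar> \<le> B * (s - r)"
  using has_integral_bound[of B "\<lambda>u. c (z u) - V (y u)" "y s - y r" r s] increment[of r s] assms
  by (simp add: cbox_interval)

text \<open>It suffices that one end of the path lies within distance \<open>R\<close> of the origin: confinement applies to
  the path itself or to the time-reversed path. The second case shows that paths starting far away do
  not come close to the origin in a short time.\<close>

lemma short_displacement:
  assumes B: "0 \<le> B" "\<And>j u. \<bar>u\<bar> \<le> R + 1 \<Longrightarrow> \<bar>c j - V u\<bar> \<le> B"
    and t: "0 \<le> t" "B * t < 1" and R: "\<bar>x\<bar> \<le> R \<or> \<bar>y t\<bar> \<le> R"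
  shows "\<bar>y t - x\<bar> \<le> B * t"
  using R
proof
  assume R: "\<bar>x\<bar> \<le> R"
  have "\<bar>y t - y 0\<bar> \<le> B * t"
  proof (rule confinement[OF _ t B(1)])
    fix s assume s: "0 \<le> s" "s \<le> t" "\<And>r. 0 \<le> r \<Longrightarrow> r \<le> s \<Longrightarrow> \<bar>y r - y 0\<bar> \<le> 1"
    have "\<bar>y u\<bar> \<le> R + 1" if "0 \<le> u" "u \<le> s" for u
      using s(3)[OF that] R start by arith
    then show "\<bar>y s - y 0\<bar> \<le> B * s"
      using increment_bound[of 0 s B] s B by simp
  qed (rule continuous_on_subset[OF path_continuous], auto)
  then show ?thesis by (simp add: start)
next
  assume R: "\<bar>y t\<bar> \<le> R"
  have "\<bar>y (t - t) - y (t - 0)\<bar> \<le> B * t"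
  proof (rule confinement[OF _ t B(1)])
    show "continuous_on {0..t} (\<lambda>s. y (t - s))"
      by (intro continuous_on_compose2[OF path_continuous] continuous_intros) auto
  next
    fix s assume s: "0 \<le> s" "s \<le> t" "\<And>r. 0 \<le> r \<Longrightarrow> r \<le> s \<Longrightarrow> \<bar>y (t - r) - y (t - 0)\<bar> \<le> 1"
    have "\<bar>y u\<bar> \<le> R + 1" if "t - s \<le> u" "u \<le> t" for u
      using s(3)[of "t - u"] that R by simp
    then have "\<bar>y t - y (t - s)\<bar> \<le> B * (t - (t - s))"
      using increment_bound[of "t - s" t B] s B by simp
    then show "\<bar>y (t - s) - y (t - 0)\<bar> \<le> B * s"
      by (simp add: abs_minus_commute)
  qed
  then show ?thesis by (simp add: start abs_minus_commute)
qed

lemma flow_before_jump: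
  assumes t: "0 < t" and i: "\<And>s. 0 \<le> s \<Longrightarrow> s < t \<Longrightarrow> z s = i" and s: "0 < s" "s < t"
  shows "(y has_real_derivative (c i - V (y s))) (at s)"
proof -
  let ?h = "\<lambda>u. c i - V (y u)"
  have eq: "y u = x + integral {0..u} ?h" if "u \<in> {0<..<t}" for u
  proof -
    have "integral {0..u} ?h = integral {0..u} (\<lambda>v. c (z v) - V (y v))"
      by (rule integral_cong) (use i that in auto)
    with increment[of 0 u] that show ?thesis by (simp add: start integral_unique)
  qed
  have "continuous_on {0..t} ?h"
    by (intro continuous_intros continuous_on_compose2[OF drift_continuous]
      continuous_on_subset[OF path_continuous]) auto
  then have "((\<lambda>u. integral {0..u} ?h) has_real_derivative ?h s) (at s within {0..t})"
    using integral_has_real_derivative[of 0 t ?h s] s by simp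
  then have "((\<lambda>u. x + integral {0..u} ?h) has_real_derivative ?h s) (at s)"
    using s at_within_Icc_at[of 0 s t] by (auto intro!: derivative_eq_intros)
  then show ?thesis
    by (rule has_field_derivative_transform_within_open[of _ _ _ "{0<..<t}"]) (use s eq in auto)
qed

text \<open>The mean value theorem measures the error by how far \<open>(c\<^sub>i - V) \<phi>'\<close> strays along the path from
  a reference value \<open>g\<close>; this asks for continuity of the product only, which suits test functions that
  are merely continuously differentiable.\<close>

lemma expansion_before_jump:
  assumes t: "0 < t" and i: "\<And>s. 0 \<le> s \<Longrightarrow> s < t \<Longrightarrow> z s = i"
    and \<phi>: "\<And>u. (\<phi> has_real_derivative \<phi>' u) (at u)"
    and near: "\<And>s. 0 < s \<Longrightarrow> s < t \<Longrightarrow> \<bar>(c i - V (y s)) * \<phi>' (y s) - g\<bar> \<le> \<eta>"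
  shows "\<bar>\<phi> (y t) - \<phi> x - t * g\<bar> \<le> t * \<eta>"
proof -
  have der: "((\<lambda>u. \<phi> (y u)) has_real_derivative (c i - V (y s)) * \<phi>' (y s)) (at s)"
    if "0 < s" "s < t" for s
    using DERIV_chain2[OF \<phi> flow_before_jump[OF t i that]] by (simp add: mult.commute)
  have "continuous_on UNIV \<phi>"
    using \<phi> by (meson DERIV_isCont continuous_at_imp_continuous_on)
  then have "continuous_on {0..t} (\<lambda>u. \<phi> (y u))"
    by (rule continuous_on_compose2) (auto intro: continuous_on_subset[OF path_continuous])
  then obtain s where s: "0 < s" "s < t"
    "\<phi> (y t) - \<phi> (y 0) = (c i - V (y s)) * \<phi>' (y s) * (t - 0)"
    using mvt[OF t, of "\<lambda>u. \<phi> (y u)" "\<lambda>s h. (c i - V (y s)) * \<phi>' (y s) * h"] der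
    unfolding has_field_derivative_def by blast
  then have "\<phi> (y t) - \<phi> x - t * g = t * ((c i - V (y s)) * \<phi>' (y s) - g)"
    by (simp add: start algebra_simps)
  then show ?thesis using near[OF s(1,2)] t by (simp add: abs_mult)
qed

text \<open>Right-continuity reduces the event that the state stays constant up to time \<open>t\<close> to countably many
  times, which makes it measurable.\<close>

lemma constant_if_constant_on_rationals:
  assumes "\<And>q. q \<in> \<rat> \<Longrightarrow> 0 \<le> q \<Longrightarrow> q < t \<Longrightarrow> z q = i" and "0 \<le> s" "s < t"
  shows "z s = i"
proof -
  obtain d where d: "d > 0" "\<And>r. s \<le> r \<Longrightarrow> r < s + d \<Longrightarrow> z r = z s"
    using constant_right[OF \<open>0 \<le> s\<close>] by blast
  obtain q where "q \<in> \<rat>" "s < q" "q < min t (s + d)"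
    using Rats_dense_in_real[of s "min t (s + d)"] d(1) \<open>s < t\<close> by auto
  with assms(1)[of q] d(2)[of q] \<open>0 \<le> s\<close> show ?thesis by auto
qed

text \<open>The crude estimate for paths with switches. The component \<open>\<phi> (z t)\<close> is compared with itself at the
  starting point; the actual change and the predicted change contribute at most \<open>t * (B * C)\<close> each.\<close>

lemma expansion_bound:
  assumes B: "\<And>j u. \<bar>u\<bar> \<le> R + 1 \<Longrightarrow> \<bar>c j - V u\<bar> \<le> B"
    and t: "0 < t" "B * t < 1" and R: "\<bar>x\<bar> \<le> R"
    and \<phi>: "\<And>j u. (\<phi> j has_real_derivative \<phi>' j u) (at u)"
    and C: "\<And>j u. \<bar>u\<bar> \<le> R + 1 \<Longrightarrow> \<bar>\<phi>' j u\<bar> \<le> C"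
  shows "\<bar>\<phi> (z t) (y t) - \<phi> (z t) x - t * ((c i - V x) * \<phi>' i x)\<bar> \<le> t * (2 * B * C)"
proof -
  have B0: "0 \<le> B" using B[of x i] R by linarith
  have disp: "\<bar>y t - x\<bar> \<le> B * t"
    by (rule short_displacement[where R = R]) (use B B0 t R in auto)
  have C0: "0 \<le> C" using C[of x i] R by linarith
  have "norm (\<phi> (z t) (y t) - \<phi> (z t) x) \<le> C * norm (y t - x)"
    by (rule field_differentiable_bound[of "{-(R+1)..R+1}" _ "\<phi>' (z t)"])
      (use C disp t R in \<open>auto intro: has_field_derivative_at_within[OF \<phi>] simp: abs_le_iff\<close>)
  also have "\<dots> \<le> C * (B * t)" using disp C0 by (simp add: mult_left_mono)
  finally have 1: "\<bar>\<phi> (z t) (y t) - \<phi> (z t) x\<bar> \<le> B * C * t" by (simp add: algebra_simps)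
  have "\<bar>(c i - V x) * \<phi>' i x\<bar> \<le> B * C"
    unfolding abs_mult using B[of x i] C[of x i] R B0 by (intro mult_mono) auto
  then have "\<bar>t * ((c i - V x) * \<phi>' i x)\<bar> \<le> t * (B * C)"
    using t by (simp add: abs_mult)
  with 1 show ?thesis by (simp add: algebra_simps)
qed

end

section \<open>Two states and vector-valued functions\<close>

lemma other_state: "j \<noteq> i \<longleftrightarrow> j = 1 - i" for i j :: 2
  using exhaust_2[of i] exhaust_2[of j] by auto

lemma uniform_limit_componentwise:
  fixes F :: "'b \<Rightarrow> 'c \<Rightarrow> real^'n"
  assumes "\<And>i. uniform_limit S (\<lambda>t x. F t x $ i) (\<lambda>x. G x $ i) net"
  shows "uniform_limit S F G net"
proof (rule uniform_limitI)
  fix e :: real assume "e > 0"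
  then have "\<forall>\<^sub>F t in net. \<forall>x\<in>S. dist (F t x $ i) (G x $ i) < e / CARD('n)" for i
    by (intro uniform_limitD assms) simp
  then have "\<forall>\<^sub>F t in net. \<forall>i. \<forall>x\<in>S. dist (F t x $ i) (G x $ i) < e / CARD('n)"
    by (simp add: eventually_all_finite)
  then show "\<forall>\<^sub>F t in net. \<forall>x\<in>S. dist (F t x) (G x) < e"
  proof (eventually_elim, intro ballI)
    fix t x assume *: "\<forall>i. \<forall>x\<in>S. dist (F t x $ i) (G x $ i) < e / CARD('n)" "x \<in> S"
    have "dist (F t x) (G x) \<le> (\<Sum>i\<in>UNIV. \<bar>F t x $ i - G x $ i\<bar>)"
      using norm_le_l1_cart[of "F t x - G x"] by (simp add: dist_norm)
    also have "\<dots> < (\<Sum>i\<in>(UNIV::'n set). e / CARD('n))"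
      by (rule sum_strict_mono) (use * in \<open>auto simp: dist_real_def\<close>)
    finally show "dist (F t x) (G x) < e" by simp
  qed
qed

lemma vector_derivative_component:
  fixes f D :: "real \<Rightarrow> real^'n"
  assumes "(f has_vector_derivative D u) (at u)"
  shows "((\<lambda>u. f u $ j) has_real_derivative D u $ j) (at u)"
  using bounded_linear.has_vector_derivative[OF bounded_linear_vec_nth assms]
  by (simp add: has_real_derivative_iff_has_vector_derivative)

lemma generator_component:
  fixes f D :: "real \<Rightarrow> real^2"
  assumes "(f has_vector_derivative D x) (at x)"
  shows "(Lambda lam *v f x + L_diag c V f x) $ i =
    (c i - V x) * D x $ i + lam i * (f x $ (1 - i) - f x $ i)"
proof -
  have "(UNIV :: 2 set) = {i, 1 - i}" using other_state[of _ i] by blast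
  then have "(Lambda lam *v f x) $ i = (\<Sum>j\<in>{i, 1 - i}. (if j = i then - lam i else lam i) * f x $ j)"
    by (simp only: matrix_vector_mult_def Lambda_def vec_lambda_beta)
  also have "\<dots> = - lam i * f x $ i + lam i * f x $ (1 - i)"
    using other_state[of "1 - i" i] by (subst sum.insert) auto
  finally have "(Lambda lam *v f x) $ i = lam i * (f x $ (1 - i) - f x $ i)"
    by (simp add: right_diff_distrib)
  then show ?thesis
    using DERIV_imp_deriv[OF vector_derivative_component[of f D x, OF assms]] by (simp add: L_diag_def L_op_def)
qed

section \<open>Paths conditioned on the initial state\<close>

locale switching_flow = prob_space M for M :: "'a measure" +
  fixes c lam :: "2 \<Rightarrow> real" and V :: "real \<Rightarrow> real"
    and \<xi> :: "real \<Rightarrow> 'a \<Rightarrow> 2" and X :: "real \<Rightarrow> real \<Rightarrow> 'a \<Rightarrow> real"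
  assumes continuous_drift: "continuous_on UNIV V"
    and markov: "two_state_markov_process M \<xi> lam"
    and initial: "measure M {\<omega> \<in> space M. \<xi> 0 \<omega> = i} > 0"
    and solution: "is_solution M c V \<xi> x (X x)"
begin

abbreviation started_in :: "2 \<Rightarrow> 'a measure" where
  "started_in i \<equiv> uniform_measure M {\<omega> \<in> space M. \<xi> 0 \<omega> = i}"

definition leaves_before :: "2 \<Rightarrow> real \<Rightarrow> 'a set" where
  "leaves_before i t = {\<omega> \<in> space M. \<exists>q\<in>\<rat> \<inter> {0..<t}. \<xi> q \<omega> \<noteq> i}"

lemma state_measurable [measurable]:
  "0 \<le> t \<Longrightarrow> \<xi> t \<in> measurable M (count_space UNIV)"
  using markov by (simp add: two_state_markov_process_def)

lemma position_measurable [measurable]: "0 \<le> t \<Longrightarrow> X x t \<in> borel_measurable M"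
  using solution[of x] by (simp add: is_solution_def)

lemma initial_event [measurable]: "{\<omega> \<in> space M. \<xi> 0 \<omega> = i} \<in> sets M"
  by measurable

lemma prob_space_started_in: "prob_space (started_in i)"
  using initial[of i] by (intro prob_space_uniform_measure) (auto simp: emeasure_eq_measure)

lemma AE_switching_path:
  "AE \<omega> in started_in i. \<xi> 0 \<omega> = i \<and> switching_path c V (\<lambda>t. \<xi> t \<omega>) x (\<lambda>t. X x t \<omega>)"
proof (rule AE_uniform_measureI[OF initial_event])
  have 1: "AE \<omega> in M. (\<forall>t\<ge>0. \<forall>\<^sub>F s in at_right t. \<xi> s \<omega> = \<xi> t \<omega>) \<and>
        (\<forall>t>0. \<exists>j. \<forall>\<^sub>F s in at_left t. \<xi> s \<omega> = j)"
    using markov by (simp add: two_state_markov_process_def)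
  have 2: "AE \<omega> in M. continuous_on {0..} (\<lambda>t. X x t \<omega>) \<and>
        (\<forall>t\<ge>0. X x t \<omega> = x - integral {0..t} (\<lambda>s. V (X x s \<omega>)) + telegraph c \<xi> t \<omega>)"
    using solution[of x] by (simp add: is_solution_def)
  show "AE \<omega> in M. \<omega> \<in> {\<omega> \<in> space M. \<xi> 0 \<omega> = i} \<longrightarrow>
      \<xi> 0 \<omega> = i \<and> switching_path c V (\<lambda>t. \<xi> t \<omega>) x (\<lambda>t. X x t \<omega>)"
    using 1 2 by eventually_elim
      (auto simp: switching_path_def continuous_drift telegraph_def)
qed

text \<open>The Markov property at time \<open>0\<close>, with no condition on the past, identifies the conditional probability of
  the other state with the transition probability, whose rate is the switching intensity.\<close>

lemma transition_rate:
  "((\<lambda>t. measure (started_in i) {\<omega> \<in> space M. \<xi> t \<omega> = 1 - i} / t) \<longlongrightarrow> lam i) (at_right 0)"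
proof -
  obtain p :: "real \<Rightarrow> 2 \<Rightarrow> 2 \<Rightarrow> real" where
    p: "\<forall>s\<ge>0. \<forall>h\<ge>0. \<forall>i j. \<forall>T e. finite T \<longrightarrow> T \<subseteq> {0..s} \<longrightarrow>
           measure M {\<omega> \<in> space M. (\<forall>r\<in>T. \<xi> r \<omega> = e r) \<and> \<xi> s \<omega> = i \<and> \<xi> (s + h) \<omega> = j} =
           measure M {\<omega> \<in> space M. (\<forall>r\<in>T. \<xi> r \<omega> = e r) \<and> \<xi> s \<omega> = i} * p h i j"
    and lim: "\<forall>i. ((\<lambda>h. p h i (1 - i) / h) \<longlongrightarrow> lam i) (at_right 0)"
    using markov unfolding two_state_markov_process_def by blast
  have "measure (started_in i) {\<omega> \<in> space M. \<xi> t \<omega> = 1 - i} = p t i (1 - i)" if "0 < t" for t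
  proof -
    have "measure (started_in i) {\<omega> \<in> space M. \<xi> t \<omega> = 1 - i} =
      measure M ({\<omega> \<in> space M. \<xi> 0 \<omega> = i} \<inter> {\<omega> \<in> space M. \<xi> t \<omega> = 1 - i})
        / measure M {\<omega> \<in> space M. \<xi> 0 \<omega> = i}"
      using initial[of i] that by (intro measure_uniform_measure) (auto simp: emeasure_eq_measure)
    also have "{\<omega> \<in> space M. \<xi> 0 \<omega> = i} \<inter> {\<omega> \<in> space M. \<xi> t \<omega> = 1 - i}
      = {\<omega> \<in> space M. \<xi> 0 \<omega> = i \<and> \<xi> t \<omega> = 1 - i}" by auto
    also have "measure M \<dots> = measure M {\<omega> \<in> space M. \<xi> 0 \<omega> = i} * p t i (1 - i)"
      using p[rule_format, of 0 t "{}" undefined i "1 - i"] that by simp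
    finally show ?thesis using initial[of i] by simp
  qed
  then show ?thesis
    by (intro Lim_transform_eventually[OF lim[rule_format]]) (auto simp: eventually_at_filter)
qed

lemma leaves_before_measurable [measurable]: "leaves_before i t \<in> sets M"
proof -
  have "leaves_before i t = (\<Union>q\<in>\<rat> \<inter> {0..<t}. {\<omega> \<in> space M. \<xi> q \<omega> \<noteq> i})"
    by (auto simp: leaves_before_def)
  also have "\<dots> \<in> sets M"
    by (rule sets.countable_UN') (auto simp: countable_rat)
  finally show ?thesis .
qed

lemma leaves_before_mono: "s \<le> t \<Longrightarrow> leaves_before i s \<subseteq> leaves_before i t"
  by (force simp: leaves_before_def)

text \<open>The events shrink as \<open>t\<close> decreases to \<open>0\<close>, and a path that belongs to all of them either does not
  start in \<open>i\<close> or is not right-continuous at \<open>0\<close>.\<close>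

lemma leaves_before_tendsto_0:
  "((\<lambda>t. measure (started_in i) (leaves_before i t)) \<longlongrightarrow> 0) (at_right 0)"
proof -
  interpret N: prob_space "started_in i" by (rule prob_space_started_in)
  let ?J = "\<lambda>n. leaves_before i (inverse (real (Suc n)))"
  have "AE \<omega> in started_in i. \<omega> \<notin> (\<Inter>n. ?J n)"
    using AE_switching_path[of i 0]
  proof eventually_elim
    case (elim \<omega>)
    then interpret switching_path c V "\<lambda>t. \<xi> t \<omega>" 0 "\<lambda>t. X 0 t \<omega>" by simp
    obtain d where d: "d > 0" "\<And>s. 0 \<le> s \<Longrightarrow> s < 0 + d \<Longrightarrow> \<xi> s \<omega> = \<xi> 0 \<omega>"
      using constant_right[OF order_refl] by blast
    obtain n where "inverse (real (Suc n)) < d" using reals_Archimedean[OF d(1)] by blast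
    moreover have "\<xi> s \<omega> = i" if "0 \<le> s" "s < d" for s
      using d(2)[of s] that elim by simp
    ultimately have "\<omega> \<notin> ?J n" by (auto simp: leaves_before_def)
    then show ?case by blast
  qed
  then have "measure (started_in i) (\<Inter>n. ?J n) = 0"
    by (subst N.prob_eq_0) auto
  moreover have "(\<lambda>n. measure (started_in i) (?J n)) \<longlonglongrightarrow> measure (started_in i) (\<Inter>n. ?J n)"
  proof (rule N.finite_Lim_measure_decseq)
    show "range ?J \<subseteq> sets (started_in i)" by auto
    show "decseq ?J"
      unfolding decseq_def by (intro allI impI leaves_before_mono le_imp_inverse_le) simp_all
  qed
  ultimately have lim: "(\<lambda>n. measure (started_in i) (?J n)) \<longlonglongrightarrow> 0" by simp
  show ?thesis
  proof (rule tendstoI)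
    fix e :: real assume "e > 0"
    then obtain n where n: "measure (started_in i) (?J n) < e"
      using order_tendstoD(2)[OF lim] by (auto simp: eventually_sequentially)
    have "measure (started_in i) (leaves_before i t) < e" if "t < inverse (real (Suc n))" for t
      using N.finite_measure_mono[OF leaves_before_mono[of t "inverse (real (Suc n))" i]] n that by simp
    then have "\<forall>\<^sub>F t in at_right 0. measure (started_in i) (leaves_before i t) < e"
      by (auto simp: eventually_at_right_field intro!: exI[of _ "inverse (real (Suc n))"])
    then show "\<forall>\<^sub>F t in at_right 0. dist (measure (started_in i) (leaves_before i t)) 0 < e"
      by (simp add: dist_real_def)
  qed
qed

lemma payoff_measurable:
  fixes f :: "real \<Rightarrow> real^2"
  assumes "continuous_on UNIV f" "0 \<le> t"
  shows "(\<lambda>\<omega>. f (X x t \<omega>) $ \<xi> t \<omega>) \<in> borel_measurable M"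
proof (rule measurable_compose_countable[where g = "\<xi> t"])
  fix j
  have "continuous_on UNIV (\<lambda>u. f u $ j)" by (intro continuous_intros assms)
  then have [measurable]: "(\<lambda>u. f u $ j) \<in> borel_measurable borel"
    by (rule borel_measurable_continuous_onI)
  show "(\<lambda>\<omega>. f (X x t \<omega>) $ j) \<in> borel_measurable M"
    using assms(2) by measurable
qed (use assms in simp)

text \<open>The two pathwise estimates, integrated. The horizon \<open>2 * t\<close> of the early switch includes \<open>t\<close> itself
  among the times at which the state of a path without such a switch is known to be \<open>i\<close>.\<close>

lemma semigroup_expansion:
  fixes f D :: "real \<Rightarrow> real^2"
  defines "g i u \<equiv> (c i - V u) * D u $ i"
  assumes f: "\<And>u. (f has_vector_derivative D u) (at u)"
    and B: "\<And>j u. \<bar>u\<bar> \<le> R + 1 \<Longrightarrow> \<bar>c j - V u\<bar> \<le> B"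
    and t: "0 < t" "B * t < 1" and R: "\<bar>x\<bar> \<le> R"
    and C: "\<And>j u. \<bar>u\<bar> \<le> R + 1 \<Longrightarrow> \<bar>D u $ j\<bar> \<le> C"
    and \<eta>: "\<And>u. \<bar>u\<bar> \<le> R + 1 \<Longrightarrow> \<bar>u - x\<bar> \<le> B * t \<Longrightarrow> \<bar>g i u - g i x\<bar> \<le> \<eta>"
  shows "\<bar>markov_semigroup M \<xi> X t f x $ i - f x $ i - t * g i x
      - measure (started_in i) {\<omega> \<in> space M. \<xi> t \<omega> = 1 - i} * (f x $ (1 - i) - f x $ i)\<bar>
    \<le> t * (\<eta> + 2 * B * C * measure (started_in i) (leaves_before i (2 * t)))"
proof -
  interpret N: prob_space "started_in i" by (rule prob_space_started_in)
  note fj = vector_derivative_component[of f D, OF f]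
  have contf: "continuous_on UNIV f"
    using f by (meson continuous_at_imp_continuous_on has_vector_derivative_continuous)
  have B0: "0 \<le> B" and \<eta>0: "0 \<le> \<eta>"
    using B[of x 0] \<eta>[of x] R t by (fastforce)+
  let ?J = "leaves_before i (2 * t)" and ?S = "{\<omega> \<in> space M. \<xi> t \<omega> = 1 - i}"
  \<comment> \<open>\<open>W\<close> is the actual value, \<open>Z\<close> its first-order prediction, \<open>E\<close> the bound for the error.\<close>
  define W where "W \<omega> = f (X x t \<omega>) $ \<xi> t \<omega>" for \<omega>
  define Z where "Z \<omega> = f x $ i + t * g i x + indicator ?S \<omega> * (f x $ (1 - i) - f x $ i)" for \<omega>
  define E where "E \<omega> = t * (\<eta> + 2 * B * C * indicator ?J \<omega>)" for \<omega>
  have [measurable]: "\<xi> t \<in> measurable M (count_space UNIV)" using t by simp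
  have [measurable]: "?S \<in> sets M" by measurable
  have W_meas [measurable]: "W \<in> borel_measurable M"
    unfolding W_def using payoff_measurable[OF contf] t by simp
  have AE: "AE \<omega> in started_in i. \<omega> \<in> space M \<and> \<bar>W \<omega> - Z \<omega>\<bar> \<le> E \<omega>"
    using AE_switching_path[of i x] AE_space
  proof eventually_elim
    case (elim \<omega>)
    then interpret switching_path c V "\<lambda>t. \<xi> t \<omega>" x "\<lambda>t. X x t \<omega>" by simp
    show ?case
    proof (cases "\<omega> \<in> ?J")
      case False
      then have stay: "\<xi> s \<omega> = i" if "0 \<le> s" "s < 2 * t" for s
        using constant_if_constant_on_rationals[of "2 * t" i s] that elim
        by (auto simp: leaves_before_def)
      have "\<bar>f (X x t \<omega>) $ i - f x $ i - t * g i x\<bar> \<le> t * \<eta>"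
      proof (rule expansion_before_jump[where \<phi> = "\<lambda>u. f u $ i", OF t(1) _ fj])
        fix s assume s: "0 < s" "s < t"
        have Bs: "B * s \<le> B * t" using s B0 by (simp add: mult_left_mono)
        have "\<bar>X x s \<omega> - x\<bar> \<le> B * s"
          by (rule short_displacement[where R = R]) (use B B0 s t R Bs in auto)
        with Bs have "\<bar>X x s \<omega> - x\<bar> \<le> B * t" by simp
        then show "\<bar>(c i - V (X x s \<omega>)) * D (X x s \<omega>) $ i - g i x\<bar> \<le> \<eta>"
          using \<eta>[of "X x s \<omega>"] R t unfolding g_def by simp
      qed (use stay in auto)
      moreover have "i \<noteq> 1 - i" using other_state[of i i] by simp
      ultimately show ?thesis
        using False stay[of t] t elim by (simp add: W_def Z_def E_def)
    next
      case True
      have "Z \<omega> = f x $ \<xi> t \<omega> + t * g i x"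
        using other_state[of "\<xi> t \<omega>" i] elim by (cases "\<xi> t \<omega> = i") (auto simp: Z_def)
      moreover have "\<bar>f (X x t \<omega>) $ \<xi> t \<omega> - f x $ \<xi> t \<omega> - t * g i x\<bar> \<le> t * (2 * B * C)"
        unfolding g_def
        by (rule expansion_bound[where \<phi> = "\<lambda>j u. f u $ j" and \<phi>' = "\<lambda>j u. D u $ j", OF B t R fj C])
      moreover have "t * (2 * B * C) \<le> E \<omega>" using True \<eta>0 t by (simp add: E_def algebra_simps)
      ultimately show ?thesis using elim by (simp add: W_def)
    qed
  qed
  have E_int: "integrable (started_in i) E" and Z_int: "integrable (started_in i) Z"
    unfolding E_def Z_def
    by (auto intro!: integrable_real_indicator simp: N.emeasure_eq_measure)
  have WZ_int: "integrable (started_in i) (\<lambda>\<omega>. W \<omega> - Z \<omega>)"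
    by (rule Bochner_Integration.integrable_bound[OF E_int]) (use AE in \<open>auto simp: Z_def\<close>)
  have "integral\<^sup>L (started_in i) W - integral\<^sup>L (started_in i) Z = (\<integral>\<omega>. W \<omega> - Z \<omega> \<partial>started_in i)"
    using Bochner_Integration.integral_add[OF WZ_int Z_int] by simp
  also have "\<bar>\<dots>\<bar> \<le> integral\<^sup>L (started_in i) E"
    using AE by (intro order_trans[OF integral_abs_bound integral_mono_AE] E_int
      integrable_abs WZ_int) auto
  finally have "\<bar>integral\<^sup>L (started_in i) W - integral\<^sup>L (started_in i) Z\<bar> \<le> integral\<^sup>L (started_in i) E" .
  moreover have "integral\<^sup>L (started_in i) E = t * (\<eta> + 2 * B * C * measure (started_in i) ?J)"
    unfolding E_def using N.prob_space by (simp add: N.emeasure_eq_measure)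
  moreover have "integral\<^sup>L (started_in i) Z =
      f x $ i + t * g i x + measure (started_in i) ?S * (f x $ (1 - i) - f x $ i)"
    unfolding Z_def using N.prob_space by (simp add: N.emeasure_eq_measure)
  ultimately show ?thesis
    by (simp add: markov_semigroup_def W_def[abs_def] diff_diff_eq add.assoc)
qed

section \<open>Short-time asymptotics of the semigroup\<close>

lemma speed_bound:
  obtains B where "0 < B" "\<And>j u. \<bar>u\<bar> \<le> R \<Longrightarrow> \<bar>c j - V u\<bar> \<le> B"
proof -
  have "bounded (V ` {-R..R})"
    by (intro compact_imp_bounded compact_continuous_image continuous_on_subset[OF continuous_drift]) auto
  then obtain b where b: "b > 0" "\<And>u. u \<in> {-R..R} \<Longrightarrow> \<bar>V u\<bar> \<le> b"
    by (auto simp: bounded_pos)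
  show ?thesis
  proof (rule that[of "\<bar>c 0\<bar> + \<bar>c 1\<bar> + b"])
    fix j :: 2 and u :: real assume "\<bar>u\<bar> \<le> R"
    with b(2)[of u] other_state[of j 0] show "\<bar>c j - V u\<bar> \<le> \<bar>c 0\<bar> + \<bar>c 1\<bar> + b"
      by (cases "j = 0") (auto simp: abs_le_iff)
  qed (use b in linarith)
qed

text \<open>The error of the difference quotient has three sources, each of which is given a share of \<open>e / 4\<close>: the
  oscillation of \<open>g\<close> over distances up to \<open>B * t\<close>, the probability of an early switch, and the deviation
  of the transition probability from its rate.\<close>

lemma locally_uniform_derivative:
  fixes f D :: "real \<Rightarrow> real^2"
  assumes f: "\<And>u. (f has_vector_derivative D u) (at u)" and D: "continuous_on UNIV D"
  shows "uniform_limit {-R..R} (\<lambda>t x. (markov_semigroup M \<xi> X t f x - f x) /\<^sub>R t)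
    (\<lambda>x. Lambda lam *v f x + L_diag c V f x) (at_right 0)"
proof (rule uniform_limit_componentwise, rule uniform_limitI)
  fix i :: 2 and e :: real assume e: "e > 0"
  have triangle: "\<bar>a - (b + d)\<bar> < e"
    if "\<bar>a - b - h\<bar> < e / 2" "\<bar>h - d\<bar> \<le> k" "k < e / 4" for a b d h k
    using that e by linarith
  define g where "g u = (c i - V u) * D u $ i" for u
  obtain B where B: "0 < B" "\<And>j u. \<bar>u\<bar> \<le> R + 1 \<Longrightarrow> \<bar>c j - V u\<bar> \<le> B" using speed_bound by blast
  have "bounded (D ` {-(R+1)..R+1})"
    by (intro compact_imp_bounded compact_continuous_image continuous_on_subset[OF D]) auto
  then obtain C where C': "\<And>u. u \<in> {-(R+1)..R+1} \<Longrightarrow> norm (D u) \<le> C"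
    unfolding bounded_iff by blast
  have C: "\<bar>D u $ j\<bar> \<le> C" if "\<bar>u\<bar> \<le> R + 1" for j u
    using order_trans[OF component_le_norm_cart C'[of u]] that by (simp add: abs_le_iff)
  have contf: "continuous_on UNIV f"
    using f by (meson continuous_at_imp_continuous_on has_vector_derivative_continuous)
  have "bounded ((\<lambda>x. f x $ (1 - i) - f x $ i) ` {-R..R})"
    by (intro compact_imp_bounded compact_continuous_image continuous_intros
        continuous_on_subset[OF contf]) auto
  then obtain F where F: "F > 0" "\<And>x. x \<in> {-R..R} \<Longrightarrow> \<bar>f x $ (1 - i) - f x $ i\<bar> \<le> F"
    by (auto simp: bounded_pos)
  have "uniformly_continuous_on {-(R+1)..R+1} g"
    unfolding g_def
    by (intro compact_uniformly_continuous continuous_intros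
        continuous_on_subset[OF D] continuous_on_subset[OF continuous_drift]) auto
  then have "\<exists>\<delta>>0. \<forall>u\<in>{-(R+1)..R+1}. \<forall>v\<in>{-(R+1)..R+1}. \<bar>v - u\<bar> < \<delta> \<longrightarrow> \<bar>g v - g u\<bar> < e / 4"
    unfolding uniformly_continuous_on_def dist_real_def using e by (elim allE[of _ "e / 4"]) simp
  then obtain \<delta> where \<delta>: "\<delta> > 0" "\<And>u v. u \<in> {-(R+1)..R+1} \<Longrightarrow> v \<in> {-(R+1)..R+1} \<Longrightarrow>
      \<bar>v - u\<bar> < \<delta> \<Longrightarrow> \<bar>g v - g u\<bar> < e / 4"
    by blast
  define q where "q t = measure (started_in i) (leaves_before i (2 * t))" for t
  define p where "p t = measure (started_in i) {\<omega> \<in> space M. \<xi> t \<omega> = 1 - i}" for t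
  have "filterlim (\<lambda>t::real. 2 * t) (at_right 0) (at_right 0)"
    unfolding filterlim_at
    by (intro conjI tendsto_mult_right_zero tendsto_ident_at) (simp add: eventually_at_filter)
  then have "((\<lambda>t. 2 * B * C * q t) \<longlongrightarrow> 2 * B * C * 0) (at_right 0)"
    unfolding q_def by (intro tendsto_intros filterlim_compose[OF leaves_before_tendsto_0])
  then have q: "\<forall>\<^sub>F t in at_right 0. 2 * B * C * q t < e / 4"
    using e by (intro order_tendstoD(2)) auto
  have "((\<lambda>t. \<bar>p t / t - lam i\<bar> * F) \<longlongrightarrow> \<bar>lam i - lam i\<bar> * F) (at_right 0)"
    unfolding p_def by (intro tendsto_intros transition_rate)
  then have p: "\<forall>\<^sub>F t in at_right 0. \<bar>p t / t - lam i\<bar> * F < e / 4"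
    using e by (intro order_tendstoD(2)) auto
  have small: "\<forall>\<^sub>F t in at_right 0. 0 < t \<and> t < min 1 \<delta> / B"
    using B \<delta> by (auto simp: eventually_at_right_field intro!: exI[of _ "min 1 \<delta> / B"])
  show "\<forall>\<^sub>F t in at_right 0. \<forall>x\<in>{-R..R}. dist (((markov_semigroup M \<xi> X t f x - f x) /\<^sub>R t) $ i)
      ((Lambda lam *v f x + L_diag c V f x) $ i) < e"
    using q p small
  proof (eventually_elim, intro ballI)
    fix t x assume q: "2 * B * C * q t < e / 4" and p: "\<bar>p t / t - lam i\<bar> * F < e / 4"
      and t: "0 < t \<and> t < min 1 \<delta> / B" and x: "x \<in> {-R..R}"
    define P where "P = markov_semigroup M \<xi> X t f x $ i"
    define \<Delta> where "\<Delta> = f x $ (1 - i) - f x $ i"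
    \<comment> \<open>Below \<open>1\<close> for the confinement, below \<open>\<delta>\<close> for the oscillation of \<open>g\<close>.\<close>
    have Bt: "B * t < min 1 \<delta>" using t B by (simp add: field_simps)
    have "\<bar>P - f x $ i - t * g x - p t * \<Delta>\<bar> \<le> t * (e / 4 + 2 * B * C * q t)"
      unfolding P_def p_def q_def g_def \<Delta>_def
    proof (rule semigroup_expansion[OF f B(2) _ _ _ C])
      fix u assume "\<bar>u\<bar> \<le> R + 1" "\<bar>u - x\<bar> \<le> B * t"
      then have "\<bar>u - x\<bar> < \<delta>" "u \<in> {-(R+1)..R+1}" using Bt by auto
      with \<delta>(2)[of x u] x show "\<bar>(c i - V u) * D u $ i - (c i - V x) * D x $ i\<bar> \<le> e / 4"
        by (simp add: g_def)
    qed (use t Bt x in \<open>auto simp: abs_le_iff\<close>)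
    also have "\<dots> < t * (e / 2)" using q t by (intro mult_strict_left_mono) auto
    finally have "\<bar>P - f x $ i - t * g x - p t * \<Delta>\<bar> / t < e / 2"
      using t by (simp add: field_simps)
    moreover have "(P - f x $ i) / t - g x - p t / t * \<Delta> = (P - f x $ i - t * g x - p t * \<Delta>) / t"
      using t by (simp add: diff_divide_distrib)
    ultimately have "\<bar>(P - f x $ i) / t - g x - p t / t * \<Delta>\<bar> < e / 2"
      using t by simp
    moreover have "\<bar>p t / t * \<Delta> - lam i * \<Delta>\<bar> \<le> \<bar>p t / t - lam i\<bar> * F"
      using F(2)[OF x] unfolding \<Delta>_def left_diff_distrib[symmetric] abs_mult
      by (intro mult_left_mono) auto
    ultimately have "\<bar>(P - f x $ i) / t - (g x + lam i * \<Delta>)\<bar> < e"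
      using p triangle by blast
    then show "dist (((markov_semigroup M \<xi> X t f x - f x) /\<^sub>R t) $ i)
      ((Lambda lam *v f x + L_diag c V f x) $ i) < e"
      unfolding generator_component[of f D x, OF f]
      by (simp add: dist_real_def P_def \<Delta>_def g_def divide_inverse mult.commute)
  qed
qed

lemma semigroup_at_0:
  fixes f :: "real \<Rightarrow> real^2"
  assumes "continuous_on UNIV f"
  shows "markov_semigroup M \<xi> X 0 f x = f x"
proof (rule vec_eq_iff[THEN iffD2], rule allI)
  fix i
  interpret N: prob_space "started_in i" by (rule prob_space_started_in)
  have "(\<integral>\<omega>. f (X x 0 \<omega>) $ \<xi> 0 \<omega> \<partial>started_in i) = (\<integral>\<omega>. f x $ i \<partial>started_in i)"
  proof (rule integral_cong_AE)
    show "AE \<omega> in started_in i. f (X x 0 \<omega>) $ \<xi> 0 \<omega> = f x $ i"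
      using AE_switching_path[of i x] by eventually_elim (auto dest: switching_path.start)
    show "(\<lambda>\<omega>. f (X x 0 \<omega>) $ \<xi> 0 \<omega>) \<in> borel_measurable (started_in i)"
      using payoff_measurable[OF assms order_refl] by simp
  qed simp
  then show "markov_semigroup M \<xi> X 0 f x $ i = f x $ i"
    using N.prob_space by (simp add: markov_semigroup_def)
qed

text \<open>A path from outside the interval of radius \<open>R + 1\<close> would have to cover a distance of more than \<open>1\<close> to
  end in the interval of radius \<open>R\<close>, where alone \<open>f\<close> may differ from \<open>0\<close>.\<close>

lemma semigroup_vanishes_far_away:
  fixes f :: "real \<Rightarrow> real^2"
  assumes f: "\<And>u. R < \<bar>u\<bar> \<Longrightarrow> f u = 0"
  shows "\<forall>\<^sub>F t in at_right 0. \<forall>x. R + 1 < \<bar>x\<bar> \<longrightarrow> markov_semigroup M \<xi> X t f x = 0"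
proof -
  obtain B where B: "0 < B" "\<And>j u. \<bar>u\<bar> \<le> R + 1 \<Longrightarrow> \<bar>c j - V u\<bar> \<le> B" using speed_bound by blast
  have "\<forall>\<^sub>F t in at_right 0. 0 < t \<and> t < 1 / B"
    using B by (auto simp: eventually_at_right_field intro!: exI[of _ "1 / B"])
  then show ?thesis
  proof (eventually_elim, intro allI impI)
    fix t x assume t: "0 < t \<and> t < 1 / B" and x: "R + 1 < \<bar>x\<bar>"
    then have Bt: "B * t < 1" using B by (simp add: field_simps)
    have "(\<integral>\<omega>. f (X x t \<omega>) $ \<xi> t \<omega> \<partial>started_in i) = 0" for i
    proof (rule integral_eq_zero_AE)
      show "AE \<omega> in started_in i. f (X x t \<omega>) $ \<xi> t \<omega> = 0"
        using AE_switching_path[of i x]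
      proof eventually_elim
        case (elim \<omega>)
        then interpret switching_path c V "\<lambda>t. \<xi> t \<omega>" x "\<lambda>t. X x t \<omega>" by simp
        have "R < \<bar>X x t \<omega>\<bar>"
        proof (rule ccontr)
          assume "\<not> R < \<bar>X x t \<omega>\<bar>"
          then have "\<bar>X x t \<omega> - x\<bar> \<le> B * t" "\<bar>X x t \<omega>\<bar> \<le> R"
            using short_displacement[of B R t] B t Bt by auto
          with x Bt show False by linarith
        qed
        then show ?case using f by simp
      qed
    qed
    then show "markov_semigroup M \<xi> X t f x = 0"
      by (simp add: markov_semigroup_def vec_eq_iff)
  qed
qed

lemma pointwise_generator_C1:
  fixes f :: "real \<Rightarrow> real^2"
  assumes "f C1_differentiable_on UNIV"
  shows "pointwise_generator (markov_semigroup M \<xi> X) f (\<lambda>x. Lambda lam *v f x + L_diag c V f x)"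
  unfolding pointwise_generator_def
proof
  fix x
  let ?P = "\<lambda>t. markov_semigroup M \<xi> X t f x" and ?g = "Lambda lam *v f x + L_diag c V f x"
  obtain D where D: "\<And>u. (f has_vector_derivative D u) (at u)" "continuous_on UNIV D"
    using assms by (auto simp: C1_differentiable_on_def)
  have contf: "continuous_on UNIV f"
    using D(1) by (meson continuous_at_imp_continuous_on has_vector_derivative_continuous)
  have "((\<lambda>t. (?P t - f x) /\<^sub>R t) \<longlongrightarrow> ?g) (at_right 0)"
    by (rule tendsto_uniform_limitI[OF locally_uniform_derivative[OF D, where R = "\<bar>x\<bar>"]]) auto
  then have "((\<lambda>t. (?P t - f x) /\<^sub>R t - ?g) \<longlongrightarrow> 0) (at_right 0)"
    by (simp add: LIM_zero)
  then have "((\<lambda>t. (?P t - ?P 0 - (t - 0) *\<^sub>R ?g) /\<^sub>R norm (t - 0)) \<longlongrightarrow> 0) (at_right 0)"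
    by (rule Lim_transform_eventually)
      (auto simp: eventually_at_filter semigroup_at_0[OF contf] scaleR_diff_right)
  then show "(?P has_vector_derivative ?g) (at 0 within {0..})"
    by (simp add: has_vector_derivative_def has_derivative_at_within at_within_Ici_at_right
        bounded_linear_scaleR_left)
qed

text \<open>The line is split into a bounded interval, on which the convergence is known to be uniform, and its
  complement, on which for small \<open>t\<close> the difference quotient and its limit are both \<open>0\<close>.\<close>

lemma uniform_generator_C1_compact_support:
  fixes f :: "real \<Rightarrow> real^2"
  assumes "f C1_differentiable_on UNIV" and "compact (closure {x. f x \<noteq> 0})"
  shows "uniform_generator (markov_semigroup M \<xi> X) f (\<lambda>x. Lambda lam *v f x + L_diag c V f x)"
  unfolding uniform_generator_def
proof (rule uniform_limitI)
  fix e :: real assume "e > 0"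
  let ?P = "\<lambda>t x. markov_semigroup M \<xi> X t f x" and ?g = "\<lambda>x. Lambda lam *v f x + L_diag c V f x"
  obtain D where D: "\<And>u. (f has_vector_derivative D u) (at u)" "continuous_on UNIV D"
    using assms by (auto simp: C1_differentiable_on_def)
  have "bounded {x. f x \<noteq> 0}"
    by (rule bounded_subset[OF compact_imp_bounded[OF assms(2)] closure_subset])
  then obtain R where "\<forall>u\<in>{x. f x \<noteq> 0}. norm u \<le> R"
    unfolding bounded_iff ..
  then have R: "f u = 0" if "R < \<bar>u\<bar>" for u
    using \<open>\<forall>u\<in>{x. f x \<noteq> 0}. norm u \<le> R\<close> that by (auto simp: not_le[symmetric])
  have g: "?g x = 0" if "R + 1 < \<bar>x\<bar>" for x
  proof -
    have "open {u. R < \<bar>u :: real\<bar>}" by (intro open_Collect_less continuous_intros)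
    then have "(f has_vector_derivative 0) (at x)"
      by (rule has_vector_derivative_transform_within_open[OF has_vector_derivative_const])
        (use that R in auto)
    moreover have "f x = 0" using that R by simp
    ultimately show ?thesis
      using generator_component[of f "\<lambda>_. 0" x] by (simp add: vec_eq_iff)
  qed
  have "\<forall>\<^sub>F t in at_right 0. \<forall>x. R + 1 < \<bar>x\<bar> \<longrightarrow> ?P t x = 0"
    by (rule semigroup_vanishes_far_away) (rule R)
  moreover have "\<forall>\<^sub>F t in at_right 0. \<forall>x\<in>{-(R+1)..R+1}. dist ((?P t x - f x) /\<^sub>R t) (?g x) < e"
    by (rule uniform_limitD[OF locally_uniform_derivative[OF D] \<open>e > 0\<close>])
  ultimately show "\<forall>\<^sub>F t in at_right 0. \<forall>x\<in>UNIV. dist ((?P t x - f x) /\<^sub>R t) (?g x) < e"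
  proof (eventually_elim, intro ballI)
    fix t x
    assume far: "\<forall>x. R + 1 < \<bar>x\<bar> \<longrightarrow> ?P t x = 0"
      and near: "\<forall>x\<in>{-(R+1)..R+1}. dist ((?P t x - f x) /\<^sub>R t) (?g x) < e"
    show "dist ((?P t x - f x) /\<^sub>R t) (?g x) < e"
    proof (cases "R + 1 < \<bar>x\<bar>")
      case True
      then show ?thesis using far g R \<open>e > 0\<close> by simp
    next
      case False
      then have "x \<in> {-(R+1)..R+1}" by auto
      with near show ?thesis by blast
    qed
  qed
qed

end

theorem theorem2p1:
  fixes U U' U'' :: "real \<Rightarrow> real"
    and xm x0 xp :: real
    and c lam :: "2 \<Rightarrow> real"
    and M :: "'a measure"
    and \<xi> :: "real \<Rightarrow> 'a \<Rightarrow> 2"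
    and X :: "real \<Rightarrow> real \<Rightarrow> 'a \<Rightarrow> real"
  assumes "double_well U U' U'' xm x0 xp"
    and "c 0 > c 1"
    and "lam 0 > 0" and "lam 1 > 0"
    and "divergent_at_critical_points U' c"
    and "prob_space M"
    and "two_state_markov_process M \<xi> lam"
    and "\<And>i. measure M {\<omega> \<in> space M. \<xi> 0 \<omega> = i} > 0"
    and "\<And>x. is_solution M c U' \<xi> x (X x)"
  shows "(\<forall>f. f C1_differentiable_on UNIV \<longrightarrow>
            pointwise_generator (markov_semigroup M \<xi> X) f (\<lambda>x. Lambda lam *v f x + L_diag c U' f x)) \<and>
         (\<forall>f. f C1_differentiable_on UNIV \<and> compact (closure {x. f x \<noteq> 0}) \<longrightarrow>
            uniform_generator (markov_semigroup M \<xi> X) f (\<lambda>x. Lambda lam *v f x + L_diag c U' f x)) \<and>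
         (\<forall>f x i. f C1_differentiable_on UNIV \<longrightarrow>
            (Lambda lam *v f x + L_diag c U' f x) $ i =
              (c i - U' x) * deriv (\<lambda>y. f y $ i) x - lam i * f x $ i + lam i * f x $ (1 - i))"
proof -
  have "continuous_on UNIV U'"
    using assms(1) unfolding double_well_def by (meson DERIV_isCont continuous_at_imp_continuous_on)
  then interpret switching_flow M c lam U' \<xi> X
    using assms(6-9) by (simp add: switching_flow_def switching_flow_axioms_def)
  have "(Lambda lam *v f x + L_diag c U' f x) $ i =
      (c i - U' x) * deriv (\<lambda>y. f y $ i) x - lam i * f x $ i + lam i * f x $ (1 - i)"
    if "f C1_differentiable_on UNIV" for f x i
  proof -
    obtain D where D: "(f has_vector_derivative D x) (at x)"
      using \<open>f C1_differentiable_on UNIV\<close> by (auto simp: C1_differentiable_on_def)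
    show ?thesis
      unfolding generator_component[of f D x, OF D]
        DERIV_imp_deriv[OF vector_derivative_component[of f D x, OF D]]
      by (simp add: right_diff_distrib)
  qed
  then show ?thesis
    using pointwise_generator_C1 uniform_generator_C1_compact_support by blast
qed

end
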